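(* Let $I$ be a finite set of $n$ items with sizes $c_i\in\mathbb{Z}_{\ge0}$ ($i\in I$), let $B\ge0$, let $\mathcal{F}=\{S\subseteq I: \sum_{i\in S}c_i\le B\}$, and let $f:2^I\to\mathbb{R}_{\ge0}$ be a submodular function with $f(\emptyset)=0$ (not necessarily monotone), given by a value oracle. There is a polynomial-time algorithm that outputs a polynomial-size collection of sets in $\mathcal{F}$ such that for every $C\in\mathcal{F}$ the collection contains a set $S$ with $f(S)\ge\frac12 f(S\cup C)$.
   Context: A function $f$ is submodular if $f(A)+f(B)\ge f(A\cup B)+f(A\cap B)$ for all $A,B$. *)

theory Defs
  imports Complex_Main "HOL-Library.Log_Nat" "HOL-Computational_Algebra.Polynomial"
begin

definition submodular_on :: "'a set \<Rightarrow> ('a set \<Rightarrow> real) \<Rightarrow> bool" where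
  "submodular_on I f \<longleftrightarrow> (\<forall>X Y. X \<subseteq> I \<longrightarrow> Y \<subseteq> I \<longrightarrow> f X + f Y \<ge> f (X \<union> Y) + f (X \<inter> Y))"

definition knapsack_feasible :: "'a set \<Rightarrow> ('a \<Rightarrow> nat) \<Rightarrow> real \<Rightarrow> 'a set set" where
  "knapsack_feasible I c B = {S. S \<subseteq> I \<and> real (\<Sum>i\<in>S. c i) \<le> B}"


text \<open>
  Algorithms with a value oracle are programs of a while-language with unbounded arrays of
  naturals and of reals; a scalar is the cell of index 0. The items are the numbers below
  \<open>n\<close>, and a set of items is passed to the oracle, or output, as an array whose first \<open>n\<close>
  cells are its characteristic vector.

  Unit cost is a reasonable time measure here. On naturals there are only addition and
  truncated subtraction, so \<open>t\<close> steps lengthen a number by \<open>O(t)\<close> bits; a program is a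
  fixed object, so the size of its expressions is a constant. Reals are only added,
  subtracted, multiplied by naturals and compared, and never converted back into naturals:
  every real that occurs is a combination of 1, the input real and oracle answers whose
  integer coefficients have polynomially many bits.
\<close>

type_synonym vname = string

datatype nexp =
    Num nat
  | Cell vname nexp
  | Add nexp nexp
  | Sub nexp nexp

datatype rexp =
    OfNat nexp
  | RCell vname nexp
  | RAdd rexp rexp
  | RSub rexp rexp
  | Scale nexp rexp

datatype bexp =
    Less nexp nexp
  | RLess rexp rexp
  | Neg bexp
  | Conj bexp bexp

datatype com =
    Skip
  | Assign vname nexp nexp
  | RAssign vname nexp rexp
  | Query vname nexp vname
  | Output vname
  | Seq com com
  | If bexp com com
  | While bexp com

record state =
  narr :: "vname \<Rightarrow> nat \<Rightarrow> nat"
  rarr :: "vname \<Rightarrow> nat \<Rightarrow> real"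
  outs :: "nat set list"

fun nval :: "nexp \<Rightarrow> state \<Rightarrow> nat" where
  "nval (Num k) s = k"
| "nval (Cell x a) s = narr s x (nval a s)"
| "nval (Add a b) s = nval a s + nval b s"
| "nval (Sub a b) s = nval a s - nval b s"

fun rval :: "rexp \<Rightarrow> state \<Rightarrow> real" where
  "rval (OfNat a) s = real (nval a s)"
| "rval (RCell x a) s = rarr s x (nval a s)"
| "rval (RAdd a b) s = rval a s + rval b s"
| "rval (RSub a b) s = rval a s - rval b s"
| "rval (Scale a b) s = real (nval a s) * rval b s"

fun bval :: "bexp \<Rightarrow> state \<Rightarrow> bool" where
  "bval (Less a b) s \<longleftrightarrow> nval a s < nval b s"
| "bval (RLess a b) s \<longleftrightarrow> rval a s < rval b s"
| "bval (Neg a) s \<longleftrightarrow> \<not> bval a s"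
| "bval (Conj a b) s \<longleftrightarrow> bval a s \<and> bval b s"

definition nwrite :: "vname \<Rightarrow> nat \<Rightarrow> nat \<Rightarrow> state \<Rightarrow> state" where
  "nwrite x i v s = s\<lparr>narr := (narr s)(x := (narr s x)(i := v))\<rparr>"

definition rwrite :: "vname \<Rightarrow> nat \<Rightarrow> real \<Rightarrow> state \<Rightarrow> state" where
  "rwrite x i v s = s\<lparr>rarr := (rarr s)(x := (rarr s x)(i := v))\<rparr>"

definition item_set :: "nat \<Rightarrow> vname \<Rightarrow> state \<Rightarrow> nat set" where
  "item_set n x s = {i. i < n \<and> narr s x i \<noteq> 0}"

text \<open>
  \<open>exec n g P s t s'\<close>: started in \<open>s\<close>, with \<open>n\<close> items and oracle \<open>g\<close>, the program \<open>P\<close>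
  terminates in \<open>s'\<close> after time \<open>t\<close>. An oracle call or an output costs \<open>n + 1\<close>,
  since a vector of \<open>n\<close> bits is transferred.
\<close>

inductive exec :: "nat \<Rightarrow> (nat set \<Rightarrow> real) \<Rightarrow> com \<Rightarrow> state \<Rightarrow> nat \<Rightarrow> state \<Rightarrow> bool"
  for n :: nat and g :: "nat set \<Rightarrow> real" where
  Skip: "exec n g Skip s 1 s"
| Assign: "exec n g (Assign x a b) s 1 (nwrite x (nval a s) (nval b s) s)"
| RAssign: "exec n g (RAssign x a b) s 1 (rwrite x (nval a s) (rval b s) s)"
| Query: "exec n g (Query x a y) s (n + 1) (rwrite x (nval a s) (g (item_set n y s)) s)"
| Output: "exec n g (Output x) s (n + 1) (s\<lparr>outs := outs s @ [item_set n x s]\<rparr>)"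
| Seq: "exec n g P s t s' \<Longrightarrow> exec n g Q s' u s'' \<Longrightarrow> exec n g (Seq P Q) s (t + u) s''"
| IfTrue: "bval b s \<Longrightarrow> exec n g P s t s' \<Longrightarrow> exec n g (If b P Q) s (t + 1) s'"
| IfFalse: "\<not> bval b s \<Longrightarrow> exec n g Q s t s' \<Longrightarrow> exec n g (If b P Q) s (t + 1) s'"
| WhileFalse: "\<not> bval b s \<Longrightarrow> exec n g (While b P) s 1 s"
| WhileTrue: "bval b s \<Longrightarrow> exec n g P s t s' \<Longrightarrow> exec n g (While b P) s' u s'' \<Longrightarrow>
    exec n g (While b P) s (t + u + 1) s''"

inductive_cases SkipE: "exec n g Skip s t s'"
inductive_cases AssignE: "exec n g (Assign x a b) s t s'"
inductive_cases RAssignE: "exec n g (RAssign x a b) s t s'"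
inductive_cases QueryE: "exec n g (Query x a y) s t s'"
inductive_cases OutputE: "exec n g (Output x) s t s'"
inductive_cases SeqE: "exec n g (Seq P Q) s t s'"
inductive_cases IfE: "exec n g (If b P Q) s t s'"
inductive_cases WhileE: "exec n g (While b P) s t s'"

lemma exec_deterministic:
  "exec n g P s t s' \<Longrightarrow> exec n g P s u s'' \<Longrightarrow> u = t \<and> s'' = s'"
proof (induction arbitrary: u s'' rule: exec.induct)
  case Skip
  then show ?case by (elim SkipE) simp
next
  case Assign
  then show ?case by (elim AssignE) simp
next
  case RAssign
  then show ?case by (elim RAssignE) simp
next
  case Query
  then show ?case by (elim QueryE) simp
next
  case Output
  then show ?case by (elim OutputE) simp
next
  case (Seq P s t s1 Q v s2)
  from Seq.prems obtain t' v' r where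
    *: "exec n g P s t' r" "exec n g Q r v' s''" "u = t' + v'"
    by (rule SeqE)
  have 1: "t' = t" "r = s1" using Seq.IH(1)[OF *(1)] by simp_all
  show ?case using Seq.IH(2)[OF *(2)[unfolded 1]] *(3) 1(1) by simp
next
  case (IfTrue b s P t s1 Q)
  from IfTrue.prems obtain t' where
    *: "exec n g P s t' s''" "u = t' + 1"
    by (rule IfE) (use IfTrue.hyps(1) in simp_all)
  show ?case using IfTrue.IH[OF *(1)] *(2) by simp
next
  case (IfFalse b s Q t s1 P)
  from IfFalse.prems obtain t' where
    *: "exec n g Q s t' s''" "u = t' + 1"
    by (rule IfE) (use IfFalse.hyps(1) in simp_all)
  show ?case using IfFalse.IH[OF *(1)] *(2) by simp
next
  case (WhileFalse b s P)
  from WhileFalse.prems show ?case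
    by (rule WhileE) (use WhileFalse.hyps in simp_all)
next
  case (WhileTrue b s P t s1 v s2)
  from WhileTrue.prems obtain t' v' r where
    *: "exec n g P s t' r" "exec n g (While b P) r v' s''" "u = t' + v' + 1"
    by (rule WhileE) (use WhileTrue.hyps(1) in simp_all)
  have 1: "t' = t" "r = s1" using WhileTrue.IH(1)[OF *(1)] by simp_all
  show ?case using WhileTrue.IH(2)[OF *(2)[unfolded 1]] *(3) 1(1) by simp
qed

definition input_state :: "nat \<Rightarrow> (nat \<Rightarrow> nat) \<Rightarrow> real \<Rightarrow> state" where
  "input_state n c B = \<lparr>
     narr = (\<lambda>x i. if x = ''n'' \<and> i = 0 then n
                   else if x = ''c'' \<and> i < n then c i else 0),
     rarr = (\<lambda>x i. if x = ''B'' \<and> i = 0 then B else 0),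
     outs = []\<rparr>"

text \<open>
  \<open>floorlog 2 k\<close> is the number of binary digits of \<open>k\<close>. Of the budget, a real, only the
  integer part is measured.
\<close>

definition input_length :: "nat \<Rightarrow> (nat \<Rightarrow> nat) \<Rightarrow> real \<Rightarrow> nat" where
  "input_length n c B = n + (\<Sum>i<n. floorlog 2 (c i)) + floorlog 2 (nat \<lfloor>B\<rfloor>)"

definition outputs_in_time ::
  "com \<Rightarrow> nat \<Rightarrow> (nat \<Rightarrow> nat) \<Rightarrow> real \<Rightarrow> (nat set \<Rightarrow> real) \<Rightarrow> nat \<Rightarrow> nat set list \<Rightarrow> bool" where
  "outputs_in_time P n c B g t Ss \<longleftrightarrow> (\<exists>s. exec n g P (input_state n c B) t s \<and> outs s = Ss)"

end

theory Submission imports Defs begin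

text \<open>
  For every first item \<open>a\<close>, build a set \<open>S\<close> from \<open>{a}\<close> by repeatedly considering the unconsidered
  item of largest marginal density, adding it if it fits and discarding it otherwise, and output
  every set on the way. Given a nonempty \<open>C\<close>, look at the start \<open>a \<in> C\<close> with the largest singleton
  value, and at the first moment an item \<open>b \<in> C\<close> is discarded (if there is none, then \<open>C \<subseteq> S\<close> at
  the end). All of \<open>C - S\<close> is still unconsidered, hence has density at most that of \<open>b\<close>, which
  in turn is at most that of each item added to \<open>S\<close>. As \<open>b\<close> does not fit, the size of
  \<open>C - S - {b}\<close> is less than that of \<open>S - {a}\<close>, so the marginal values of \<open>C - S - {b}\<close> sum up
  to at most \<open>f S - f {a}\<close>, while that of \<open>b\<close> is at most \<open>f {b} \<le> f {a}\<close>. Together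
  \<open>f (S \<union> C) - f S \<le> f S\<close>.
\<close>

section \<open>Timed weakest preconditions\<close>

text \<open>Total correctness: \<open>wp\<close> asserts that a terminating run exists, and by
  \<open>exec_deterministic\<close> it is the only one. The postcondition also receives the running
  time, so time bounds compose along with the state assertions.\<close>

definition wp ::
  "nat \<Rightarrow> (nat set \<Rightarrow> real) \<Rightarrow> com \<Rightarrow> (nat \<Rightarrow> state \<Rightarrow> bool) \<Rightarrow> state \<Rightarrow> bool" where
  "wp n g P Q s \<longleftrightarrow> (\<exists>t s'. exec n g P s t s' \<and> Q t s')"

lemma wp_mono: "wp n g P Q s \<Longrightarrow> (\<And>t s'. Q t s' \<Longrightarrow> Q' t s') \<Longrightarrow> wp n g P Q' s"
  unfolding wp_def by blast

lemma wp_Skip [simp]: "wp n g Skip Q s \<longleftrightarrow> Q 1 s"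
  unfolding wp_def by (metis exec.Skip SkipE)

lemma wp_Assign [simp]: "wp n g (Assign x a b) Q s \<longleftrightarrow> Q 1 (nwrite x (nval a s) (nval b s) s)"
  unfolding wp_def by (metis exec.Assign AssignE)

lemma wp_RAssign [simp]: "wp n g (RAssign x a b) Q s \<longleftrightarrow> Q 1 (rwrite x (nval a s) (rval b s) s)"
  unfolding wp_def by (metis exec.RAssign RAssignE)

lemma wp_Query [simp]:
  "wp n g (Query x a y) Q s \<longleftrightarrow> Q (n + 1) (rwrite x (nval a s) (g (item_set n y s)) s)"
  unfolding wp_def using exec.Query by (fastforce elim: QueryE)

lemma wp_Output [simp]:
  "wp n g (Output x) Q s \<longleftrightarrow> Q (n + 1) (s\<lparr>outs := outs s @ [item_set n x s]\<rparr>)"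
  unfolding wp_def using exec.Output by (fastforce elim: OutputE)

lemma wp_Seq [simp]:
  "wp n g (Seq P R) Q s \<longleftrightarrow> wp n g P (\<lambda>t. wp n g R (\<lambda>u. Q (t + u))) s"
  unfolding wp_def by (blast intro: exec.intros elim: SeqE)

lemma wp_If [simp]:
  "wp n g (If b P R) Q s \<longleftrightarrow>
     (if bval b s then wp n g P (\<lambda>t. Q (t + 1)) s else wp n g R (\<lambda>t. Q (t + 1)) s)"
proof (cases "bval b s")
  case True
  then show ?thesis
    unfolding wp_def using IfTrue[of b s n g P _ _ R] by (auto elim!: IfE)
next
  case False
  then show ?thesis
    unfolding wp_def using IfFalse[of b s n g R _ _ P] by (auto elim!: IfE)
qed

definition for_items :: "vname \<Rightarrow> com \<Rightarrow> com" where
  "for_items x P = Seq (Assign x (Num 0) (Num 0))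
     (While (Less (Cell x (Num 0)) (Cell ''n'' (Num 0)))
       (Seq P (Assign x (Num 0) (Add (Cell x (Num 0)) (Num 1)))))"

text \<open>Each iteration pays 2 beyond the body, for the guard and the increment; the final 2 pays
  for the initialisation and the failing guard. The step re-establishes the invariant after the
  increment, so \<open>I i\<close> always describes the loop head.\<close>

lemma wp_for_items:
  assumes init: "I 0 (nwrite x 0 0 s)"
    and counters: "\<And>i s. I i s \<Longrightarrow> narr s x 0 = i \<and> narr s ''n'' 0 = N"
    and step: "\<And>i s. i < N \<Longrightarrow> I i s \<Longrightarrow>
      wp n g P (\<lambda>t s'. t \<le> T \<and> narr s' x 0 = i \<and> I (Suc i) (nwrite x 0 (Suc i) s')) s"
  shows "wp n g (for_items x P) (\<lambda>t s'. t \<le> N * (T + 2) + 2 \<and> I N s') s"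
proof -
  let ?W = "While (Less (Cell x (Num 0)) (Cell ''n'' (Num 0)))
       (Seq P (Assign x (Num 0) (Add (Cell x (Num 0)) (Num 1))))"
  have loop: "wp n g ?W (\<lambda>t s'. t \<le> d * (T + 2) + 1 \<and> I N s') s"
    if "I i s" "i + d = N" for i d s
    using that
  proof (induction d arbitrary: i s)
    case 0
    then have "\<not> bval (Less (Cell x (Num 0)) (Cell ''n'' (Num 0))) s"
      using counters by fastforce
    from WhileFalse[OF this] 0 show ?case
      unfolding wp_def by fastforce
  next
    case (Suc d)
    have i: "i < N" using Suc.prems by simp
    have b: "bval (Less (Cell x (Num 0)) (Cell ''n'' (Num 0))) s"
      using counters[OF Suc.prems(1)] i by simp
    obtain t s1 where body: "exec n g P s t s1" "t \<le> T" "narr s1 x 0 = i"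
        "I (Suc i) (nwrite x 0 (Suc i) s1)"
      using step[OF i Suc.prems(1)] unfolding wp_def by blast
    have "exec n g (Assign x (Num 0) (Add (Cell x (Num 0)) (Num 1))) s1 1 (nwrite x 0 (Suc i) s1)"
      using exec.Assign[of n g x "Num 0" "Add (Cell x (Num 0)) (Num 1)" s1] body(3) by simp
    note body_exec = exec.Seq[OF body(1) this]
    obtain u s2 where rest: "exec n g ?W (nwrite x 0 (Suc i) s1) u s2"
        "u \<le> d * (T + 2) + 1" "I N s2"
      using Suc.IH[OF body(4)] Suc.prems(2) unfolding wp_def by auto
    show ?case
      unfolding wp_def using WhileTrue[OF b body_exec rest(1)] body(2) rest(2,3)
      by (intro exI[of _ "(t + 1) + u + 1"] exI[of _ s2]) auto
  qed
  have *: "wp n g ?W (\<lambda>t s'. t \<le> N * (T + 2) + 1 \<and> I N s') (nwrite x 0 0 s)"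
    using loop[OF init, of N] by simp
  show ?thesis
    unfolding for_items_def by (simp only: wp_Seq wp_Assign nval.simps, rule wp_mono[OF *], simp)
qed

lemma narr_nwrite [simp]: "narr (nwrite x i v s) = (narr s)(x := (narr s x)(i := v))"
  and rarr_nwrite [simp]: "rarr (nwrite x i v s) = rarr s"
  and outs_nwrite [simp]: "outs (nwrite x i v s) = outs s"
  and narr_rwrite [simp]: "narr (rwrite x i w s) = narr s"
  and rarr_rwrite [simp]: "rarr (rwrite x i w s) = (rarr s)(x := (rarr s x)(i := w))"
  and outs_rwrite [simp]: "outs (rwrite x i w s) = outs s"
  by (simp_all add: nwrite_def rwrite_def)

lemma item_set_nwrite [simp]:
  "item_set n x (nwrite y i v s) =
     (if x = y \<and> i < n then if v = 0 then item_set n x s - {i} else insert i (item_set n x s)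
      else item_set n x s)"
  by (auto simp: item_set_def)

lemma item_set_rwrite [simp]: "item_set n x (rwrite y i w s) = item_set n x s"
  by (simp add: item_set_def)

lemma item_set_outs [simp]: "item_set n x (s\<lparr>outs := Ss\<rparr>) = item_set n x s"
  by (simp add: item_set_def)

section \<open>The program\<close>

abbreviation "scalar x \<equiv> Cell x (Num 0)"
abbreviation "rscalar x \<equiv> RCell x (Num 0)"

text \<open>
  \<open>S\<close> is the current set, \<open>k\<close> its size and \<open>f\<close> its value; \<open>D\<close> holds the items considered so far;
  \<open>b\<close> is the best candidate and \<open>h\<close> its marginal value. The value \<open>b = n\<close> stands for ``no
  candidate''; it needs no special treatment, because cell \<open>n\<close> of the size array is 0 and
  cell \<open>n\<close> of \<open>S\<close> and \<open>D\<close> is ignored.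
\<close>

definition add_best :: com where
  "add_best =
     Seq (Assign ''D'' (scalar ''b'') (Num 1))
    (Seq (If (RLess (rscalar ''B'') (OfNat (Add (scalar ''k'') (Cell ''c'' (scalar ''b''))))) Skip
           (Seq (Assign ''S'' (scalar ''b'') (Num 1))
                (Assign ''k'' (Num 0) (Add (scalar ''k'') (Cell ''c'' (scalar ''b''))))))
    (Seq (Query ''f'' (Num 0) ''S'')
         (Output ''S'')))"

definition take_candidate :: com where
  "take_candidate =
     Seq (Assign ''b'' (Num 0) (scalar ''j'')) (RAssign ''h'' (Num 0) (rscalar ''m''))"

text \<open>
  Densities are compared by cross multiplication. This is no transitive relation in the
  presence of sizes 0, so a candidate of size 0 without positive marginal value always gives way.
\<close>

definition scan_step :: com where
  "scan_step =
     If (Less (Num 0) (Cell ''D'' (scalar ''j''))) Skip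
      (Seq (Assign ''S'' (scalar ''j'') (Num 1))
      (Seq (Query ''m'' (Num 0) ''S'')
      (Seq (RAssign ''m'' (Num 0) (RSub (rscalar ''m'') (rscalar ''f'')))
      (Seq (Assign ''S'' (scalar ''j'') (Num 0))
           (If (Conj (Neg (Less (Num 0) (Cell ''c'' (scalar ''b''))))
                     (Neg (RLess (OfNat (Num 0)) (rscalar ''h''))))
               take_candidate
               (If (RLess (Scale (Cell ''c'' (scalar ''j'')) (rscalar ''h''))
                          (Scale (Cell ''c'' (scalar ''b'')) (rscalar ''m'')))
                   take_candidate Skip))))))"

definition find_best :: com where
  "find_best =
     Seq (Assign ''b'' (Num 0) (scalar ''n''))
    (Seq (RAssign ''h'' (Num 0) (OfNat (Num 0)))
         (for_items ''j'' scan_step))"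

text \<open>The arrays still hold the result of the previous start. Only cells below
  \<open>n\<close> need clearing, since \<open>item_set\<close> sees no others.\<close>

definition reset_sets :: com where
  "reset_sets =
     Seq (for_items ''j'' (Seq (Assign ''S'' (scalar ''j'') (Num 0))
                               (Assign ''D'' (scalar ''j'') (Num 0))))
         (Assign ''k'' (Num 0) (Num 0))"

text \<open>The start is treated as a chosen candidate, so an oversized \<open>a\<close> is
  discarded by the same code. After it, \<open>n - 1\<close> rounds exhaust the items; the last
  round finds no candidate and outputs the current set again.\<close>

definition greedy_from :: com where
  "greedy_from =
     Seq reset_sets
    (Seq (Assign ''b'' (Num 0) (scalar ''a''))
    (Seq add_best
         (for_items ''r'' (Seq find_best add_best))))"

text \<open>All cells of \<open>S\<close> are 0 at first, so the first output is the empty set. It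
  serves \<open>C = {}\<close>, which contains no start.\<close>

definition knapsack_program :: com where
  "knapsack_program = Seq (Output ''S'') (for_items ''a'' greedy_from)"

section \<open>Density greedy\<close>

locale knapsack =
  fixes n :: nat and g :: "nat set \<Rightarrow> real" and c :: "nat \<Rightarrow> nat" and B :: real
  assumes budget_nonneg: "0 \<le> B"
    and nonneg: "X \<subseteq> {..<n} \<Longrightarrow> 0 \<le> g X"
    and submodular: "submodular_on {..<n} g"
    and empty: "g {} = 0"
begin

definition gain :: "nat set \<Rightarrow> nat \<Rightarrow> real" where
  "gain S i = g (insert i S) - g S"

abbreviation feasible :: "nat set set" where
  "feasible \<equiv> knapsack_feasible {..<n} c B"

text \<open>Diminishing returns: submodularity for \<open>insert i X\<close> and \<open>Y\<close>,
  which meet exactly in \<open>X\<close>.\<close>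

lemma gain_antimono:
  assumes "X \<subseteq> Y" "Y \<subseteq> {..<n}" "i < n" "i \<notin> Y"
  shows "gain Y i \<le> gain X i"
proof -
  have "g (insert i X \<union> Y) + g (insert i X \<inter> Y) \<le> g (insert i X) + g Y"
    using submodular assms unfolding submodular_on_def by (metis (no_types) dual_order.trans insert_subset lessThan_iff)
  moreover have "insert i X \<union> Y = insert i Y" "insert i X \<inter> Y = X"
    using assms by auto
  ultimately show ?thesis by (simp add: gain_def)
qed

text \<open>Add the items of \<open>T\<close> one by one; by diminishing returns each contributes at
  most its marginal value over \<open>S\<close>.\<close>

lemma union_le_sum_gain:
  assumes "finite T" "S \<subseteq> {..<n}" "T \<subseteq> {..<n}" "S \<inter> T = {}"
  shows "g (S \<union> T) - g S \<le> (\<Sum>i\<in>T. gain S i)"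
  using assms
proof (induction T)
  case empty
  then show ?case by simp
next
  case (insert i T)
  have "gain (S \<union> T) i \<le> gain S i"
    using insert.prems insert.hyps by (intro gain_antimono) auto
  with insert show ?case by (simp add: gain_def)
qed

definition densest :: "nat set \<Rightarrow> nat set \<Rightarrow> nat \<Rightarrow> bool" where
  "densest S R b \<longleftrightarrow> b \<in> R \<and> (\<forall>i\<in>R. gain S i * c b \<le> gain S b * c i)"

text \<open>The density of \<open>S - {a}\<close> is at least that of every unconsidered item, denominators cleared.\<close>

definition dense_over :: "nat \<Rightarrow> nat set \<Rightarrow> nat set \<Rightarrow> bool" where
  "dense_over a S D \<longleftrightarrow>
     (\<forall>i\<in>{..<n} - D. gain S i * (real (sum c S) - c a) \<le> (g S - g {a}) * c i)"

text \<open>Marginal values only fall, so the left side grows by at most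
  \<open>gain S i * c b\<close>, while the right side grows by exactly
  \<open>gain S b * c i\<close>. The choice of \<open>b\<close> compares these two
  increments.\<close>

lemma dense_over_insert:
  assumes "dense_over a S D" "densest S ({..<n} - D) b" "a \<in> S" "S \<subseteq> D" "D \<subseteq> {..<n}"
  shows "dense_over a (insert b S) (insert b D)"
  unfolding dense_over_def
proof
  fix i assume i: "i \<in> {..<n} - insert b D"
  have b: "b < n" "b \<notin> D" and cross: "gain S i * c b \<le> gain S b * c i"
    using assms(2) i by (auto simp: densest_def)
  have fin: "finite S" using assms(4,5) finite_subset[of S "{..<n}"] by auto
  \<comment> \<open>The multiplier below is thus nonnegative, so a smaller marginal value gives a
    smaller product.\<close>
  have "c a \<le> sum c S" using assms(3) fin by (simp add: member_le_sum)
  moreover have "gain (insert b S) i \<le> gain S i"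
    using assms i b by (intro gain_antimono) auto
  ultimately have "gain (insert b S) i * (real (sum c S) - c a + c b)
      \<le> gain S i * (real (sum c S) - c a + c b)"
    by (intro mult_right_mono) linarith+
  also have "\<dots> \<le> (g S - g {a}) * c i + gain S b * c i"
    unfolding distrib_left using assms(1) i cross by (intro add_mono) (auto simp: dense_over_def)
  also have "\<dots> = (g (insert b S) - g {a}) * c i"
    by (simp add: gain_def algebra_simps)
  also have "real (sum c S) - c a + c b = real (sum c (insert b S)) - c a"
    using b assms(4) fin by (auto simp: sum.insert_if)
  finally show "gain (insert b S) i * (real (sum c (insert b S)) - c a)
      \<le> (g (insert b S) - g {a}) * c i" .
qed

text \<open>This is the first moment at which an item of \<open>C\<close> fails to fit:
  \<open>C \<inter> D \<subseteq> S\<close> says that none was discarded before.\<close>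

lemma discarded_item_bound:
  assumes C: "C \<in> feasible" "a \<in> C" "\<And>i. i \<in> C \<Longrightarrow> g {i} \<le> g {a}"
    and sets: "a \<in> S" "S \<subseteq> D" "D \<subseteq> {..<n}" "C \<inter> D \<subseteq> S"
    and dense: "dense_over a S D" "densest S ({..<n} - D) b"
    and b: "b \<in> C" "B < real (sum c S + c b)" and S: "real (sum c S) \<le> B"
  shows "g (S \<union> C) \<le> 2 * g S"
proof -
  have Cn: "C \<subseteq> {..<n}" and CB: "real (sum c C) \<le> B"
    using C(1) by (auto simp: knapsack_feasible_def)
  have fin: "finite C" "finite S"
    using Cn sets finite_subset[of _ "{..<n}"] by blast+
  have Sn: "S \<subseteq> {..<n}" using sets by auto
  let ?R = "C - S"
  have R: "?R \<subseteq> {..<n} - D" using Cn sets by auto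
  \<comment> \<open>\<open>S\<close> fits and \<open>b\<close> does not fit beside it, so
    \<open>b\<close> has positive size, which can be cancelled later.\<close>
  have cb: "0 < real (c b)" using b(2) S by simp
  have bR: "b \<in> ?R" using dense(2) b(1) sets by (auto simp: densest_def)
  have cross: "gain S i * c b \<le> gain S b * c i" if "i \<in> ?R" for i
    using dense(2) R that by (auto simp: densest_def)
  have union: "g (S \<union> C) - g S \<le> (\<Sum>i\<in>?R. gain S i)"
    using union_le_sum_gain[of ?R S] fin Sn Cn by (auto simp: Un_Diff_cancel)
  show ?thesis
  \<comment> \<open>If the densest remaining item gains nothing, no item of \<open>?R\<close> does.
    Otherwise its positive gain may multiply the comparison of sizes.\<close>
  proof (cases "gain S b \<le> 0")
    case True
    have "gain S i \<le> 0" if "i \<in> ?R" for i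
    proof -
      have "gain S i * c b \<le> 0"
        using cross[OF that] True by (meson dual_order.trans mult_nonpos_nonneg of_nat_0_le_iff)
      then show ?thesis using cb by (simp add: mult_le_0_iff)
    qed
    then have "(\<Sum>i\<in>?R. gain S i) \<le> 0" by (intro sum_nonpos)
    then show ?thesis using union nonneg[OF Sn] by linarith
  next
    case False
    have split: "(\<Sum>i\<in>?R. gain S i) = gain S b + (\<Sum>i\<in>?R - {b}. gain S i)"
      using fin bR by (simp add: sum.remove)
    \<comment> \<open>\<open>a\<close> lies in both \<open>C\<close> and \<open>S\<close>, so its
      size counts in \<open>C\<close> besides that of \<open>?R\<close>; this is where the
      subtracted \<open>c a\<close> comes from.\<close>
    have "insert a ?R \<subseteq> C" "a \<notin> ?R" using C(2) sets(1) by auto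
    then have "c a + sum c ?R \<le> sum c C"
      using sum_mono2[OF fin(1), of "insert a ?R" c] fin by (simp del: insert_subset)
    moreover have "sum c ?R = c b + sum c (?R - {b})"
      using fin bR by (simp add: sum.remove)
    ultimately have size: "real (sum c (?R - {b})) \<le> real (sum c S) - c a"
      using CB b(2) by linarith
    have "(\<Sum>i\<in>?R - {b}. gain S i) * c b \<le> gain S b * real (sum c (?R - {b}))"
      unfolding of_nat_sum sum_distrib_left sum_distrib_right
      by (intro sum_mono cross) simp
    also have "\<dots> \<le> gain S b * (real (sum c S) - c a)"
      using size False by (intro mult_left_mono) auto
    \<comment> \<open>The density invariant is applied to \<open>b\<close> itself, which is still
      unconsidered.\<close>
    also have "\<dots> \<le> (g S - g {a}) * c b"
      using dense(1) R bR by (auto simp: dense_over_def)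
    finally have "(\<Sum>i\<in>?R - {b}. gain S i) \<le> g S - g {a}"
      using cb by simp
    moreover have "gain S b \<le> gain {} b"
      using bR Cn Sn by (intro gain_antimono) auto
    then have "gain S b \<le> g {a}"
      using C(3)[OF b(1)] by (simp add: gain_def empty)
    ultimately show ?thesis using union split by linarith
  qed
qed

section \<open>The invariant of a greedy run\<close>

definition half_good :: "nat set list \<Rightarrow> nat set \<Rightarrow> bool" where
  "half_good Ss C \<longleftrightarrow> (\<exists>S\<in>set Ss. g S \<ge> 1/2 * g (S \<union> C))"

lemma half_good_append: "half_good Ss C \<Longrightarrow> half_good (Ss @ Ts) C"
  by (auto simp: half_good_def)

definition starts :: "nat \<Rightarrow> nat set \<Rightarrow> bool" where
  "starts a C \<longleftrightarrow> C \<in> feasible \<and> a \<in> C \<and> (\<forall>i\<in>C. g {i} \<le> g {a})"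

text \<open>The program does not know \<open>C\<close>, so the invariant speaks of all
  \<open>C\<close> with start \<open>a\<close> at once. For each, either an earlier output already
  suffices, or no item of \<open>C\<close> has been discarded and the density bound still
  holds.\<close>

definition greedy_state :: "nat \<Rightarrow> nat set \<Rightarrow> nat set \<Rightarrow> nat set list \<Rightarrow> bool" where
  "greedy_state a S D Ss \<longleftrightarrow> S \<in> feasible \<and> S \<subseteq> D \<and> D \<subseteq> {..<n} \<and> S \<in> set Ss \<and>
     set Ss \<subseteq> feasible \<and>
     (\<forall>C. starts a C \<longrightarrow> half_good Ss C \<or> (a \<in> S \<and> C \<inter> D \<subseteq> S \<and> dense_over a S D))"

text \<open>If \<open>a\<close> does not fit, no feasible \<open>C\<close> contains it and the claim
  about \<open>C\<close> is vacuous. Otherwise both sides of the density bound are 0.\<close>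

lemma greedy_state_init:
  assumes "a < n" "set Ss \<subseteq> feasible"
    "S = (if B < real (c a) then {} else {a})"
  shows "greedy_state a S {a} (Ss @ [S])"
proof -
  have fS: "S \<in> feasible"
    using assms budget_nonneg by (auto simp: knapsack_feasible_def)
  have "S = {a}" if "starts a C" for C
  proof -
    have "C \<in> feasible" "a \<in> C" using that by (auto simp: starts_def)
    then have "c a \<le> sum c C" "real (sum c C) \<le> B"
      by (auto simp: knapsack_feasible_def intro!: member_le_sum finite_subset[of C "{..<n}"])
    then have "real (c a) \<le> B" by linarith
    then show ?thesis using assms(3) by simp
  qed
  then show ?thesis
    using fS assms by (auto simp: greedy_state_def dense_over_def split: if_splits)
qed

lemma greedy_state_step:
  assumes st: "greedy_state a S D Ss" and b: "densest S ({..<n} - D) b"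
    and S': "S' = (if B < real (sum c S + c b) then S else insert b S)"
  shows "greedy_state a S' (insert b D) (Ss @ [S'])"
proof -
  have S: "S \<in> feasible" "S \<subseteq> D" "D \<subseteq> {..<n}" "S \<in> set Ss" "set Ss \<subseteq> feasible"
    using st by (auto simp: greedy_state_def)
  have bD: "b < n" "b \<notin> D" using b by (auto simp: densest_def)
  have fin: "finite S" using S finite_subset[of S "{..<n}"] by blast
  have S'f: "S' \<in> feasible"
    using S(1) S' bD S(2) fin by (auto simp: knapsack_feasible_def sum.insert_if split: if_splits)
  have "half_good (Ss @ [S']) C \<or>
      (a \<in> S' \<and> C \<inter> insert b D \<subseteq> S' \<and> dense_over a S' (insert b D))" if C: "starts a C" for C
  proof (cases "half_good Ss C")
    case True
    then show ?thesis by (simp add: half_good_append)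
  next
    case False
    then have aS: "a \<in> S" "C \<inter> D \<subseteq> S" "dense_over a S D"
      using st C by (auto simp: greedy_state_def)
    show ?thesis
    proof (cases "B < real (sum c S + c b)")
      case unfit: True
      \<comment> \<open>Discarding an item of \<open>C\<close> would make \<open>S\<close> good for
        \<open>C\<close>, and \<open>S\<close> has already been output.\<close>
      have "b \<notin> C"
      proof
        assume "b \<in> C"
        then have "g (S \<union> C) \<le> 2 * g S"
          using discarded_item_bound[of C a S D b] C aS S b unfit
          by (auto simp: starts_def knapsack_feasible_def)
        then have "half_good Ss C" using S(4) unfolding half_good_def by force
        with False show False ..
      qed
      then show ?thesis using unfit S' aS by (auto simp: dense_over_def)
    next
      case fit: False
      then show ?thesis using S' aS dense_over_insert[OF aS(3) b aS(1) S(2,3)] by auto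
    qed
  qed
  then show ?thesis
    using S'f S S' bD unfolding greedy_state_def by auto
qed

text \<open>With all items considered and none of \<open>C\<close> discarded, \<open>C\<close> is
  contained in \<open>S\<close>, so \<open>S \<union> C = S\<close>.\<close>

lemma greedy_state_finished:
  assumes "greedy_state a S {..<n} Ss" "starts a C"
  shows "half_good Ss C"
proof (cases "half_good Ss C")
  case False
  have "C \<subseteq> {..<n}" using assms(2) by (simp add: starts_def knapsack_feasible_def)
  with False have "S \<union> C = S" "S \<in> set Ss" "S \<subseteq> {..<n}"
    using assms unfolding greedy_state_def by blast+
  then show ?thesis using nonneg[of S] by (auto simp: half_good_def intro!: bexI[of _ S])
qed

section \<open>Scanning for the densest item\<close>

text \<open>The second disjunct is the void candidate \<open>b = n\<close> of the program.\<close>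

definition best_below :: "nat set \<Rightarrow> nat set \<Rightarrow> nat \<Rightarrow> nat \<Rightarrow> real \<Rightarrow> bool" where
  "best_below S D j b h \<longleftrightarrow>
     (densest S ({..<j} - D) b \<and> h = gain S b \<and>
      (c b = 0 \<and> h \<le> 0 \<longrightarrow> (\<forall>i\<in>{..<j} - D. c i = 0 \<and> gain S i \<le> 0))) \<or>
     (b = n \<and> h = 0 \<and> {..<j} \<subseteq> D)"

lemma best_below_skip: "best_below S D j b h \<Longrightarrow> j \<in> D \<Longrightarrow> best_below S D (Suc j) b h"
proof -
  assume "best_below S D j b h" "j \<in> D"
  moreover have "{..<Suc j} - D = {..<j} - D" using \<open>j \<in> D\<close> by (auto simp: less_Suc_eq)
  ultimately show ?thesis by (auto simp: best_below_def less_Suc_eq)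
qed

text \<open>If there is a candidate, the implication in \<open>best_below\<close> says that all
  earlier items have size 0 and no positive gain, like the candidate itself. Any \<open>j\<close> is
  at least as good as such items.\<close>

lemma best_below_void:
  assumes "best_below S D j b h" "j < n" "j \<notin> D" "b < n \<Longrightarrow> c b = 0" "h \<le> 0"
  shows "best_below S D (Suc j) j (gain S j)"
proof -
  have zero: "c i = 0 \<and> gain S i \<le> 0" if "i < j" "i \<notin> D" for i
    using assms that by (auto simp: best_below_def densest_def)
  then have "gain S i * c j \<le> gain S j * c i" if "i < Suc j" "i \<notin> D" for i
    using that by (cases "i = j") (auto simp: mult_nonpos_nonneg)
  then show ?thesis
    using zero assms(3) by (auto simp: best_below_def densest_def less_Suc_eq)
qed

text \<open>For \<open>c b > 0\<close> this is transitivity through \<open>b\<close>, cancelling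
  \<open>c b\<close>. For \<open>c b = 0\<close> the strict inequality forces \<open>h < 0\<close>,
  and then all earlier items have size 0 and no positive gain.\<close>

lemma best_below_better:
  assumes best: "best_below S D j b h" and j: "j \<notin> D" and "b < n"
    and better: "real (c j) * h < c b * gain S j"
  shows "best_below S D (Suc j) j (gain S j)"
proof -
  have b: "densest S ({..<j} - D) b" "h = gain S b"
      "c b = 0 \<and> h \<le> 0 \<longrightarrow> (\<forall>i\<in>{..<j} - D. c i = 0 \<and> gain S i \<le> 0)"
    using best \<open>b < n\<close> unfolding best_below_def by blast+
  have "gain S i * c j \<le> gain S j * c i" if i: "i \<in> {..<j} - D" for i
  proof (cases "c b = 0")
    case True
    with better have "h \<le> 0" by (simp add: mult_less_0_iff)
    then show ?thesis using b(3) True i by (simp add: mult_nonpos_nonneg)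
  next
    case False
    have "gain S i * c b * c j \<le> gain S b * c i * c j"
      using b(1) i by (intro mult_right_mono) (auto simp: densest_def)
    also have "\<dots> = real (c i) * (real (c j) * h)" using b(2) by simp
    also have "\<dots> \<le> real (c i) * (real (c b) * gain S j)" using better by (intro mult_left_mono) auto
    finally have "(gain S i * c j) * c b \<le> (gain S j * c i) * c b" by (simp add: mult_ac)
    then show ?thesis using False by simp
  qed
  then have "densest S ({..<Suc j} - D) j"
    using j by (auto simp: densest_def less_Suc_eq)
  moreover have "\<not> (c j = 0 \<and> gain S j \<le> 0)"
    using better by (auto simp: mult_less_0_iff zero_less_mult_iff)
  ultimately show ?thesis by (auto simp: best_below_def)
qed

lemma best_below_keep:
  assumes "best_below S D j b h" "j \<notin> D" "b < n" "0 < c b \<or> 0 < h"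
    and "\<not> real (c j) * h < c b * gain S j"
  shows "best_below S D (Suc j) b h"
proof -
  have b: "densest S ({..<j} - D) b" "h = gain S b"
    using assms(1,3) by (auto simp: best_below_def)
  have "gain S j * c b \<le> gain S b * c j"
    using assms(5) b(2) by (simp add: mult.commute)
  then have "densest S ({..<Suc j} - D) b"
    using b(1) by (auto simp: densest_def less_Suc_eq)
  then show ?thesis using b(2) assms(4) by (auto simp: best_below_def)
qed

section \<open>Correctness of the program\<close>

definition inputs :: "state \<Rightarrow> bool" where
  "inputs s \<longleftrightarrow> narr s ''n'' 0 = n \<and> (\<forall>i<n. narr s ''c'' i = c i) \<and> narr s ''c'' n = 0 \<and>
     rarr s ''B'' 0 = B"

definition current :: "nat \<Rightarrow> nat set \<Rightarrow> nat set \<Rightarrow> nat set list \<Rightarrow> state \<Rightarrow> bool" where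
  "current a S D Ss s \<longleftrightarrow> inputs s \<and> narr s ''a'' 0 = a \<and> item_set n ''S'' s = S \<and>
     item_set n ''D'' s = D \<and> narr s ''k'' 0 = sum c S \<and> outs s = Ss"

text \<open>The oracle call takes \<open>n + 1\<close> of the time, the rest of the longest branch
  8.\<close>

lemma scan_step_correct:
  assumes "current a S D Ss s" "rarr s ''f'' 0 = g S" "narr s ''r'' 0 = r" "narr s ''j'' 0 = j" "j < n"
    "best_below S D j (narr s ''b'' 0) (rarr s ''h'' 0)" "S \<subseteq> D"
  shows "wp n g scan_step (\<lambda>t s'. t \<le> n + 9 \<and> current a S D Ss s' \<and> rarr s' ''f'' 0 = g S \<and>
    narr s' ''r'' 0 = r \<and> narr s' ''j'' 0 = j \<and>
    best_below S D (Suc j) (narr s' ''b'' 0) (rarr s' ''h'' 0)) s"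
proof (cases "j \<in> D")
  case True
  then have "0 < narr s ''D'' j" using assms by (auto simp: current_def item_set_def)
  then show ?thesis
    using assms best_below_skip True by (simp add: scan_step_def)
next
  case False
  let ?b = "narr s ''b'' 0" and ?h = "rarr s ''h'' 0"
  have D: "narr s ''D'' j = 0" using False assms by (auto simp: current_def item_set_def)
  \<comment> \<open>The scan sets cell \<open>j\<close> of \<open>S\<close> for the oracle call and
    then clears it; as \<open>j\<close> was not in \<open>S\<close>, this restores
    \<open>S\<close>.\<close>
  have jS: "S - {j} = S" using False assms by auto
  have cj: "narr s ''c'' j = c j" using assms by (auto simp: current_def inputs_def)
  have bn: "?b \<le> n" using assms by (auto simp: best_below_def densest_def)
  have cb: "narr s ''c'' ?b = (if ?b < n then c ?b else 0)"
    using assms bn by (auto simp: current_def inputs_def)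
  have void: "\<not> ?b < n \<Longrightarrow> ?h = 0"
    using assms(5,6) by (auto simp: best_below_def densest_def)
  \<comment> \<open>The void candidate reads size 0 and has \<open>h = 0\<close>, so it is covered
    here too.\<close>
  let ?weak = "narr s ''c'' ?b = 0 \<and> ?h \<le> 0"
  let ?replace = "?weak \<or> real (c j) * ?h < real (narr s ''c'' ?b) * gain S j"
  have best: "best_below S D (Suc j) (if ?replace then j else ?b) (if ?replace then gain S j else ?h)"
  proof (cases ?weak)
    case True
    then show ?thesis using best_below_void[OF assms(6,5) False] cb by (auto split: if_splits)
  next
    case nonweak: False
    then have "?b < n" using cb void by fastforce
    then show ?thesis
      using nonweak cb best_below_better[OF assms(6) False \<open>?b < n\<close>]
        best_below_keep[OF assms(6) False \<open>?b < n\<close>] by auto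
  qed
  have S: "item_set n ''S'' s = S" using assms by (simp add: current_def)
  have g: "g (insert j S) - g S = gain S j" by (simp add: gain_def)
  show ?thesis
    using assms(1-5) D jS cj best
    by (simp add: scan_step_def take_candidate_def current_def inputs_def S g not_less)
      (auto split: if_splits)
qed

lemma find_best_correct:
  assumes "current a S D Ss s" "rarr s ''f'' 0 = g S" "narr s ''r'' 0 = r" "S \<subseteq> D"
  shows "wp n g find_best (\<lambda>t s'. t \<le> n * (n + 11) + 4 \<and> current a S D Ss s' \<and>
    rarr s' ''f'' 0 = g S \<and> narr s' ''r'' 0 = r \<and>
    best_below S D n (narr s' ''b'' 0) (rarr s' ''h'' 0)) s"
proof -
  define I where "I j s \<longleftrightarrow> current a S D Ss s \<and> rarr s ''f'' 0 = g S \<and> narr s ''r'' 0 = r \<and>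
    narr s ''j'' 0 = j \<and> best_below S D j (narr s ''b'' 0) (rarr s ''h'' 0)" for j s
  let ?s = "rwrite ''h'' 0 0 (nwrite ''b'' 0 n s)"
  have "wp n g (for_items ''j'' scan_step) (\<lambda>t s'. t \<le> n * (n + 9 + 2) + 2 \<and> I n s') ?s"
  proof (rule wp_for_items)
    show "I 0 (nwrite ''j'' 0 0 ?s)"
      using assms by (simp add: I_def current_def inputs_def best_below_def)
    show "narr s ''j'' 0 = i \<and> narr s ''n'' 0 = n" if "I i s" for i s
      using that by (simp add: I_def current_def inputs_def)
    show "wp n g scan_step (\<lambda>t s'. t \<le> n + 9 \<and> narr s' ''j'' 0 = i \<and>
        I (Suc i) (nwrite ''j'' 0 (Suc i) s')) s" if "i < n" "I i s" for i s
    proof (rule wp_mono[OF scan_step_correct])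
      show "current a S D Ss s" "rarr s ''f'' 0 = g S" "narr s ''r'' 0 = r" "narr s ''j'' 0 = i"
        "best_below S D i (narr s ''b'' 0) (rarr s ''h'' 0)" "i < n" "S \<subseteq> D"
        using that assms(4) by (simp_all add: I_def)
    qed (simp add: I_def current_def inputs_def)
  qed
  moreover have "narr s ''n'' 0 = n" using assms by (simp add: current_def inputs_def)
  ultimately show ?thesis
    unfolding find_best_def by simp (erule wp_mono, simp add: I_def add.commute)
qed

lemma add_best_correct:
  assumes "current a S D Ss s" "narr s ''r'' 0 = r" "narr s ''b'' 0 = b" "b \<le> n" "b \<notin> S"
    and S': "S' = (if b = n \<or> B < real (sum c S + c b) then S else insert b S)"
    and D': "D' = (if b = n then D else insert b D)"
  shows "wp n g add_best (\<lambda>t s'. t \<le> 2 * n + 6 \<and> current a S' D' (Ss @ [S']) s' \<and>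
    rarr s' ''f'' 0 = g S' \<and> narr s' ''r'' 0 = r) s"
proof -
  have fin: "finite S" using assms(1) by (auto simp: current_def item_set_def)
  have cells: "narr s ''c'' b = (if b < n then c b else 0)" "item_set n ''S'' s = S"
      "item_set n ''D'' s = D" "narr s ''k'' 0 = sum c S" "rarr s ''B'' 0 = B"
    using assms by (auto simp: current_def inputs_def)
  \<comment> \<open>For \<open>b = n\<close> the writes hit cell \<open>n\<close>, which
    \<open>item_set\<close> ignores, and \<open>k\<close> can only grow by 0.\<close>
  consider "b = n" | "b < n" "B < real (sum c S + c b)" | "b < n" "\<not> B < real (sum c S + c b)"
    using \<open>b \<le> n\<close> by linarith
  then show ?thesis
    using assms(1-3,5) fin
    by cases (simp_all add: add_best_def S' D' cells current_def inputs_def)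
qed

text \<open>A void candidate arises only when \<open>D\<close> is everything. Hence each round
  considers a new item until none is left, which the cardinality bound records.\<close>

lemma greedy_state_next:
  assumes st: "greedy_state a S D Ss" and best: "best_below S D n b h"
    and S': "S' = (if b = n \<or> B < real (sum c S + c b) then S else insert b S)"
    and D': "D' = (if b = n then D else insert b D)"
  shows "greedy_state a S' D' (Ss @ [S'])" "min n (Suc (card D)) \<le> card D'"
proof -
  have D: "D \<subseteq> {..<n}" using st by (simp add: greedy_state_def)
  consider "b = n" "{..<n} \<subseteq> D" | "b < n" "b \<notin> D" "densest S ({..<n} - D) b"
    using best by (auto simp: best_below_def densest_def)
  then have "greedy_state a S' D' (Ss @ [S']) \<and> min n (Suc (card D)) \<le> card D'"
  proof cases
    case 1
    then have "D = {..<n}" using D by simp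
    then show ?thesis
      using st 1 S' D' by (auto simp: greedy_state_def half_good_append)
  next
    case 2
    have "finite D" using D finite_subset by blast
    then show ?thesis using greedy_state_step[OF st 2(3), of S'] 2 S' D' by simp
  qed
  then show "greedy_state a S' D' (Ss @ [S'])" "min n (Suc (card D)) \<le> card D'" by auto
qed

lemma reset_sets_correct:
  assumes "inputs s" "narr s ''a'' 0 = a" "outs s = Ss"
  shows "wp n g reset_sets (\<lambda>t s'. t \<le> 4 * n + 3 \<and> current a {} {} Ss s') s"
proof -
  define I where "I j s \<longleftrightarrow> inputs s \<and> narr s ''a'' 0 = a \<and> outs s = Ss \<and> narr s ''j'' 0 = j \<and>
    (\<forall>i<j. narr s ''S'' i = 0 \<and> narr s ''D'' i = 0)" for j s
  have "wp n g (for_items ''j'' (Seq (Assign ''S'' (scalar ''j'') (Num 0))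
      (Assign ''D'' (scalar ''j'') (Num 0)))) (\<lambda>t s'. t \<le> n * (2 + 2) + 2 \<and> I n s') s"
    by (rule wp_for_items) (use assms in \<open>auto simp: I_def inputs_def less_Suc_eq\<close>)
  then show ?thesis
    unfolding reset_sets_def
    by simp (erule wp_mono, auto simp: I_def current_def inputs_def item_set_def)
qed

lemma greedy_from_correct:
  assumes "inputs s" "narr s ''a'' 0 = a" "a < n" "outs s = Ss" "set Ss \<subseteq> feasible"
  shows "wp n g greedy_from (\<lambda>t s'. t \<le> n ^ 3 + 13 * n\<^sup>2 + 18 * n + 12 \<and>
    inputs s' \<and> narr s' ''a'' 0 = a \<and> set Ss \<subseteq> set (outs s') \<and> set (outs s') \<subseteq> feasible \<and>
    length (outs s') \<le> length Ss + (n + 1) \<and> (\<forall>C. starts a C \<longrightarrow> half_good (outs s') C)) s"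
proof -
  let ?first = "if B < real (c a) then {} else {a}"
  \<comment> \<open>\<open>Ts\<close> collects the outputs of this run. The start counts as one
    considered item, hence \<open>Suc r\<close>; the minimum accounts for the last, void
    round.\<close>
  define I where "I r s \<longleftrightarrow> narr s ''r'' 0 = r \<and> (\<exists>S D Ts. current a S D (Ss @ Ts) s \<and>
    rarr s ''f'' 0 = g S \<and> greedy_state a S D (Ss @ Ts) \<and> min n (Suc r) \<le> card D \<and>
    length Ts = Suc r)" for r s
  have round: "wp n g (Seq find_best add_best) (\<lambda>t s'. t \<le> n * (n + 11) + 4 + (2 * n + 6) \<and>
      narr s' ''r'' 0 = r \<and> I (Suc r) (nwrite ''r'' 0 (Suc r) s')) s" if I: "I r s" for r s
  proof -
    from I obtain S D Ts where *: "current a S D (Ss @ Ts) s" "rarr s ''f'' 0 = g S"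
        "greedy_state a S D (Ss @ Ts)" "min n (Suc r) \<le> card D" "length Ts = Suc r"
        "narr s ''r'' 0 = r"
      unfolding I_def by blast
    have SD: "S \<subseteq> D" using *(3) by (simp add: greedy_state_def)
    show ?thesis
      unfolding wp_Seq
    proof (rule wp_mono[OF find_best_correct[OF *(1,2,6) SD]], elim conjE)
      fix t s1
      assume t: "t \<le> n * (n + 11) + 4" and s1: "current a S D (Ss @ Ts) s1" "narr s1 ''r'' 0 = r"
        and best: "best_below S D n (narr s1 ''b'' 0) (rarr s1 ''h'' 0)"
      let ?b = "narr s1 ''b'' 0"
      define S' where "S' = (if ?b = n \<or> B < real (sum c S + c ?b) then S else insert ?b S)"
      define D' where "D' = (if ?b = n then D else insert ?b D)"
      note nxt = greedy_state_next[OF *(3) best S'_def D'_def]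
      have b: "?b \<le> n" "?b \<notin> S"
        using best SD *(3) by (auto simp: best_below_def densest_def greedy_state_def)
      show "wp n g add_best (\<lambda>u s'. t + u \<le> n * (n + 11) + 4 + (2 * n + 6) \<and>
          narr s' ''r'' 0 = r \<and> I (Suc r) (nwrite ''r'' 0 (Suc r) s')) s1"
      proof (rule wp_mono[OF add_best_correct[OF s1 refl b S'_def D'_def]], elim conjE, intro conjI)
        fix u s2
        assume s2: "current a S' D' ((Ss @ Ts) @ [S']) s2" "rarr s2 ''f'' 0 = g S'"
        have "current a S' D' (Ss @ (Ts @ [S'])) (nwrite ''r'' 0 (Suc r) s2)"
          using s2(1) by (simp add: current_def inputs_def)
        then show "I (Suc r) (nwrite ''r'' 0 (Suc r) s2)"
          unfolding I_def using nxt s2(2) *(4,5)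
          by (intro conjI exI[of _ S'] exI[of _ D'] exI[of _ "Ts @ [S']"]) auto
      qed (use t in simp_all)
    qed
  qed
  have rounds: "wp n g (for_items ''r'' (Seq find_best add_best))
      (\<lambda>t s'. t \<le> n * (n * (n + 11) + 4 + (2 * n + 6) + 2) + 2 \<and> I n s') s"
    if "current a ?first {a} (Ss @ [?first]) s" "rarr s ''f'' 0 = g ?first" for s
  proof (rule wp_for_items)
    have "greedy_state a ?first {a} (Ss @ [?first])"
      using assms by (intro greedy_state_init) auto
    moreover have "current a ?first {a} (Ss @ [?first]) (nwrite ''r'' 0 0 s)"
      using that(1) by (simp add: current_def inputs_def)
    ultimately show "I 0 (nwrite ''r'' 0 0 s)"
      unfolding I_def using that(2)
      by (intro conjI exI[of _ ?first] exI[of _ "{a}"] exI[of _ "[?first]"]) auto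
    show "narr s ''r'' 0 = i \<and> narr s ''n'' 0 = n" if "I i s" for i s
      using that by (auto simp: I_def current_def inputs_def)
    show "wp n g (Seq find_best add_best) (\<lambda>t s'. t \<le> n * (n + 11) + 4 + (2 * n + 6) \<and>
        narr s' ''r'' 0 = i \<and> I (Suc i) (nwrite ''r'' 0 (Suc i) s')) s" if "I i s" for i s
      using round that by blast
  qed
  have final: "inputs s' \<and> narr s' ''a'' 0 = a \<and> set Ss \<subseteq> set (outs s') \<and>
      set (outs s') \<subseteq> feasible \<and> length (outs s') \<le> length Ss + (n + 1) \<and>
      (\<forall>C. starts a C \<longrightarrow> half_good (outs s') C)" if "I n s'" for s'
  proof -
    from that obtain S D Ts where *: "current a S D (Ss @ Ts) s'"
        "greedy_state a S D (Ss @ Ts)" "n \<le> card D" "length Ts = Suc n"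
      unfolding I_def by auto
    have "D = {..<n}"
      using *(2,3) by (intro card_seteq) (auto simp: greedy_state_def)
    then have "\<forall>C. starts a C \<longrightarrow> half_good (Ss @ Ts) C"
      using greedy_state_finished *(2) by blast
    then show ?thesis
      using * by (auto simp: current_def greedy_state_def)
  qed
  have main: "wp n g add_best (\<lambda>t. wp n g (for_items ''r'' (Seq find_best add_best))
      (\<lambda>u s'. t + u \<le> 2 * n + 6 + (n * (n * (n + 11) + 4 + (2 * n + 6) + 2) + 2) \<and> I n s')) s"
    if "current a {} {} Ss s" "narr s ''b'' 0 = a" for s
  proof -
    have "wp n g add_best (\<lambda>t s'. t \<le> 2 * n + 6 \<and> current a ?first {a} (Ss @ [?first]) s' \<and>
        rarr s' ''f'' 0 = g ?first \<and> narr s' ''r'' 0 = narr s ''r'' 0) s"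
      by (rule add_best_correct[OF that(1) refl that(2)]) (use assms(3) in auto)
    then show ?thesis
      by (rule wp_mono) (elim conjE, rule wp_mono[OF rounds], simp_all)
  qed
  show ?thesis
    unfolding greedy_from_def wp_Seq wp_Assign
  proof (rule wp_mono[OF reset_sets_correct[OF assms(1,2,4)]], elim conjE)
    fix t s1
    assume t: "t \<le> 4 * n + 3" and s1: "current a {} {} Ss s1"
    let ?s = "nwrite ''b'' (nval (Num 0) s1) (nval (scalar ''a'') s1) s1"
    have "current a {} {} Ss ?s" "narr ?s ''b'' 0 = a"
      using s1 by (simp_all add: current_def inputs_def)
    from main[OF this] show "wp n g add_best (\<lambda>u. wp n g (for_items ''r'' (Seq find_best add_best))
      (\<lambda>v s'. t + (1 + (u + v)) \<le> n ^ 3 + 13 * n\<^sup>2 + 18 * n + 12 \<and>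
        inputs s' \<and> narr s' ''a'' 0 = a \<and> set Ss \<subseteq> set (outs s') \<and> set (outs s') \<subseteq> feasible \<and>
        length (outs s') \<le> length Ss + (n + 1) \<and> (\<forall>C. starts a C \<longrightarrow> half_good (outs s') C))) ?s"
    proof (elim wp_mono, elim conjE, intro conjI[OF _ final])
      fix u v
      assume "u + v \<le> 2 * n + 6 + (n * (n * (n + 11) + 4 + (2 * n + 6) + 2) + 2)"
      then show "t + (1 + (u + v)) \<le> n ^ 3 + 13 * n\<^sup>2 + 18 * n + 12"
        using t by (simp add: power2_eq_square power3_eq_cube algebra_simps)
    qed
  qed
qed

text \<open>For nonempty \<open>C\<close>, an item of largest singleton value in \<open>C\<close> is
  a valid start, and every start is tried.\<close>

lemma half_good_program_output:
  assumes "C \<in> feasible" "{} \<in> set Ss" "\<And>a C. a < n \<Longrightarrow> starts a C \<Longrightarrow> half_good Ss C"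
  shows "half_good Ss C"
proof (cases "C = {}")
  case True
  then show ?thesis using assms(2) empty by (auto simp: half_good_def intro!: bexI[of _ "{}"])
next
  case False
  have C: "C \<subseteq> {..<n}" using assms(1) by (simp add: knapsack_feasible_def)
  then have "finite C" using finite_subset by blast
  then have "Max ((\<lambda>i. g {i}) ` C) \<in> (\<lambda>i. g {i}) ` C" using False by (intro Max_in) auto
  then obtain a where "a \<in> C" "g {a} = Max ((\<lambda>i. g {i}) ` C)" by auto
  then have "starts a C" using assms(1) \<open>finite C\<close> by (simp add: starts_def)
  then show ?thesis using assms(3) C \<open>a \<in> C\<close> by blast
qed

lemma knapsack_program_correct:
  "wp n g knapsack_program (\<lambda>t s. t \<le> 14 * (1 + n) ^ 4 \<and> length (outs s) \<le> 1 + n + n\<^sup>2 \<and>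
    set (outs s) \<subseteq> feasible \<and> (\<forall>C\<in>feasible. half_good (outs s) C)) (input_state n c B)"
proof -
  \<comment> \<open>The outputs are the initial empty set and \<open>n + 1\<close> sets per
    completed start.\<close>
  define I where "I k s \<longleftrightarrow> inputs s \<and> narr s ''a'' 0 = k \<and> {} \<in> set (outs s) \<and>
    set (outs s) \<subseteq> feasible \<and> length (outs s) \<le> 1 + k * (n + 1) \<and>
    (\<forall>a<k. \<forall>C. starts a C \<longrightarrow> half_good (outs s) C)" for k s
  let ?s = "(input_state n c B)\<lparr>outs := [{}]\<rparr>"
  let ?T = "n ^ 3 + 13 * n\<^sup>2 + 18 * n + 12"
  have "wp n g (for_items ''a'' greedy_from) (\<lambda>t s'. t \<le> n * (?T + 2) + 2 \<and> I n s') ?s"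
  proof (rule wp_for_items)
    show "I 0 (nwrite ''a'' 0 0 ?s)"
      using budget_nonneg by (simp add: I_def inputs_def input_state_def knapsack_feasible_def)
    show "narr s ''a'' 0 = i \<and> narr s ''n'' 0 = n" if "I i s" for i s
      using that by (simp add: I_def inputs_def)
    show "wp n g greedy_from (\<lambda>t s'. t \<le> ?T \<and> narr s' ''a'' 0 = i \<and>
        I (Suc i) (nwrite ''a'' 0 (Suc i) s')) s" if i: "i < n" and I: "I i s" for i s
    proof (rule wp_mono[OF greedy_from_correct[of s i "outs s"]], goal_cases)
      case (6 t s')
      \<comment> \<open>Outputs are never withdrawn, so the guarantees of earlier starts
        persist.\<close>
      have "half_good (outs s') C" if "a < Suc i" "starts a C" for a C
        using that I 6 unfolding I_def half_good_def less_Suc_eq by blast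
      then show ?case using 6 I by (auto simp: I_def inputs_def)
    qed (use i I in \<open>simp_all add: I_def\<close>)
  qed
  moreover have "item_set n ''S'' (input_state n c B) = {}"
    by (simp add: item_set_def input_state_def)
  moreover have "outs (input_state n c B) = []"
    by (simp add: input_state_def)
  ultimately have "wp n g knapsack_program
      (\<lambda>t s'. t \<le> n + 1 + (n * (?T + 2) + 2) \<and> I n s') (input_state n c B)"
    unfolding knapsack_program_def by simp
  then show ?thesis
  proof (rule wp_mono, elim conjE, intro conjI)
    fix t s
    assume t: "t \<le> n + 1 + (n * (?T + 2) + 2)" and s: "I n s"
    note t
    also have "n + 1 + (n * (?T + 2) + 2) \<le> 14 * (1 + n) ^ 4"
      by (simp add: power_numeral_reduce algebra_simps)
    finally show "t \<le> 14 * (1 + n) ^ 4" .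
    show "length (outs s) \<le> 1 + n + n\<^sup>2" "set (outs s) \<subseteq> feasible"
      using s by (simp_all add: I_def power2_eq_square)
    show "\<forall>C\<in>feasible. half_good (outs s) C"
      using s half_good_program_output by (auto simp: I_def)
  qed
qed

end

text \<open>The numbering \<open>item\<close> pulls sizes and oracle back to \<open>{..<n}\<close>,
  where the program runs; its outputs are carried forward to \<open>I\<close>.\<close>

theorem theorem3:
  "\<exists>(P :: com) (p :: nat poly) (q :: nat poly).
     \<forall>(I :: 'a set) (n :: nat) (item :: nat \<Rightarrow> 'a) (c :: 'a \<Rightarrow> nat) (B :: real) (f :: 'a set \<Rightarrow> real).
       finite I \<longrightarrow> card I = n \<longrightarrow> bij_betw item {..<n} I \<longrightarrow> 0 \<le> B \<longrightarrow>
       (\<forall>S. S \<subseteq> I \<longrightarrow> 0 \<le> f S) \<longrightarrow> submodular_on I f \<longrightarrow> f {} = 0 \<longrightarrow>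
       (\<exists>t Ss.
          outputs_in_time P n (\<lambda>i. c (item i)) B (\<lambda>S. f (item ` S)) t Ss \<and>
          t \<le> poly p (input_length n (\<lambda>i. c (item i)) B) \<and>
          length Ss \<le> poly q n \<and>
          (\<forall>S\<in>set Ss. item ` S \<in> knapsack_feasible I c B) \<and>
          (\<forall>C\<in>knapsack_feasible I c B. \<exists>S\<in>set Ss. f (item ` S) \<ge> 1/2 * f (item ` S \<union> C)))"
proof (rule exI[of _ knapsack_program], rule exI[of _ "smult 14 ([:1, 1:] ^ 4)"],
    rule exI[of _ "[:1, 1, 1:]"], intro allI impI, goal_cases)
  case (1 I n item c B f)
  let ?g = "\<lambda>S. f (item ` S)" and ?c = "\<lambda>i. c (item i)"
  have inj: "inj_on item {..<n}" and onto: "item ` {..<n} = I"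
    using 1(3) by (auto simp: bij_betw_def)
  have subI: "item ` X \<subseteq> I" if "X \<subseteq> {..<n}" for X
    using onto that by blast
  interpret knapsack n ?g ?c B
  proof
    show "0 \<le> B" "f (item ` {}) = 0" using 1 by simp_all
    show "0 \<le> f (item ` X)" if "X \<subseteq> {..<n}" for X using 1(5) subI[OF that] by blast
    \<comment> \<open>Injectivity makes images commute with intersections, as submodularity of the
      pulled-back oracle requires.\<close>
    have "item ` (X \<inter> Y) = item ` X \<inter> item ` Y" if "X \<subseteq> {..<n}" "Y \<subseteq> {..<n}" for X Y
      using inj that by (rule inj_on_image_Int)
    then show "submodular_on {..<n} ?g"
      using 1(6) subI by (simp add: submodular_on_def image_Un)
  qed
  have feasible_iff: "item ` X \<in> knapsack_feasible I c B \<longleftrightarrow> X \<in> feasible" if "X \<subseteq> {..<n}" for X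
    using that subI[OF that] inj_on_subset[OF inj that]
    by (simp add: knapsack_feasible_def sum.reindex)
  obtain t s where run: "exec n ?g knapsack_program (input_state n ?c B) t s"
    and s: "t \<le> 14 * (1 + n) ^ 4" "length (outs s) \<le> 1 + n + n\<^sup>2"
      "set (outs s) \<subseteq> feasible" "\<forall>C\<in>feasible. half_good (outs s) C"
    using knapsack_program_correct unfolding wp_def by blast
  show ?case
  proof (intro exI[of _ t] exI[of _ "outs s"] conjI ballI)
    show "outputs_in_time knapsack_program n ?c B ?g t (outs s)"
      using run by (auto simp: outputs_in_time_def)
    \<comment> \<open>The number of items is a summand of the input length; the bit lengths of the
      sizes and of the budget are not charged for.\<close>
    have "14 * (1 + n) ^ 4 \<le> 14 * (1 + input_length n ?c B) ^ 4"
      by (intro mult_left_mono power_mono) (simp_all add: input_length_def)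
    with s(1) have "t \<le> 14 * (1 + input_length n ?c B) ^ 4" by (rule order_trans)
    then show "t \<le> poly (smult 14 ([:1, 1:] ^ 4)) (input_length n ?c B)" by simp
    show "length (outs s) \<le> poly [:1, 1, 1:] n"
      using s(2) by (simp add: power2_eq_square)
    show "item ` S \<in> knapsack_feasible I c B" if "S \<in> set (outs s)" for S
      using that s(3) feasible_iff[of S] by (auto simp: knapsack_feasible_def)
    fix C
    assume C: "C \<in> knapsack_feasible I c B"
    define C' where "C' = {..<n} \<inter> item -` C"
    have C': "item ` C' = C"
      using C onto by (auto simp: C'_def knapsack_feasible_def)
    then have "C' \<in> feasible"
      using C feasible_iff[of C'] by (simp add: C'_def)
    then have "half_good (outs s) C'" using s(4) by blast
    then show "\<exists>S\<in>set (outs s). f (item ` S) \<ge> 1/2 * f (item ` S \<union> C)"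
      by (simp add: half_good_def image_Un C')
  qed
qed

end
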